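(* Let $\lambda$ be a nonzero real number and $r$ a positive integer. For all positive integers $n,k$, $$H_{\lambda}^{(r)}(n+1+r,k+r)=H_{\lambda}^{(r)}(n+r,k+r-1)+(k+r+n\lambda)H_{\lambda}^{(r)}(n+r,k+r).$$
   Context: For $\lambda\in\mathbb{R}$, $\lambda\neq 0$: $\langle x\rangle_{0,\lambda}=1$, $\langle x\rangle_{n,\lambda}=x(x+\lambda)\cdots(x+(n-1)\lambda)$ for $n\ge 1$. The falling factorial is $(x)_0=1$, $(x)_n=x(x-1)\cdots(x-n+1)$ for $n\ge 1$. For a positive integer $r$, the heterogeneous $r$-Stirling numbers of the second kind $H_\lambda^{(r)}(n+r,k+r)$ are defined by the polynomial identity $\langle x+r\rangle_{n,\lambda}=\sum_{k=0}^{n}H_{\lambda}^{(r)}(n+r,k+r)(x)_{k}$ for $n\ge 0$, with $H_\lambda^{(r)}(n+r,k+r)=0$ for $k<0$ or $k>n$. *)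

theory Defs
  imports Complex_Main
begin

definition rising_factorial :: "real \<Rightarrow> real \<Rightarrow> nat \<Rightarrow> real" where
  "rising_factorial lam x n = (\<Prod>i<n. x + real i * lam)"

definition falling_factorial :: "real \<Rightarrow> nat \<Rightarrow> real" where
  "falling_factorial x n = (\<Prod>i<n. x - real i)"

(* hstirling2 lam r N K is H_lam^(r)(N, K): the two arguments are the shifted ones, N = n + r and
   K = k + r, so "k < 0 or k > n" reads "K < r or K > n + r".  The defining identity in the
   polynomial variable x is stated for all real x.  The description is proper because the falling
   factorials of degree at most n form a basis of the real polynomials of degree at most n, and
   the remaining values are prescribed.  Rows N < r do not occur in the mathematical definition
   and are set to zero. *)
definition hstirling2 :: "real \<Rightarrow> nat \<Rightarrow> nat \<Rightarrow> nat \<Rightarrow> real" where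
  "hstirling2 lam r = (THE H.
     (\<forall>n. \<forall>x::real. rising_factorial lam (x + real r) n
        = (\<Sum>k=0..n. H (n + r) (k + r) * falling_factorial x k)) \<and>
     (\<forall>n K. K < r \<or> K > n + r \<longrightarrow> H (n + r) K = 0) \<and>
     (\<forall>N K. N < r \<longrightarrow> H N K = 0))"

end

(* The recurrence determines a triangular array, and the splitting
   x + r + n lam = (x - k) + (k + r + n lam) shows row by row that this array satisfies the
   defining identity.  An array satisfying the identity is unique, because evaluation at
   x = 0, 1, 2, ... is a triangular system in the coefficients of the falling factorials.
   Hence the array is the one described by hstirling2, and the recurrence holds. *)
theory Submission
  imports Defs
begin

lemma rising_factorial_Suc:
  "rising_factorial lam x (Suc n) = rising_factorial lam x n * (x + real n * lam)"
  by (simp add: rising_factorial_def)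

lemma falling_factorial_Suc:
  "falling_factorial x (Suc n) = falling_factorial x n * (x - real n)"
  by (simp add: falling_factorial_def)

lemma falling_factorial_of_nat_eq_0_iff: "falling_factorial (real m) k = 0 \<longleftrightarrow> m < k"
  by (auto simp: falling_factorial_def)

text \<open>At \<open>x = real m\<close> the terms with \<open>k > m\<close> vanish and those with
  \<open>k < m\<close> cancel by strong induction. Only the term \<open>k = m\<close> survives, and
  its factor \<open>falling_factorial (real m) m\<close> is nonzero.\<close>

lemma falling_factorial_coeffs_unique:
  fixes a b :: "nat \<Rightarrow> real"
  assumes eq: "\<And>x. (\<Sum>k=0..n. a k * falling_factorial x k) = (\<Sum>k=0..n. b k * falling_factorial x k)"
    and "m \<le> n"
  shows "a m = b m"
  using \<open>m \<le> n\<close>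
proof (induction m rule: less_induct)
  case (less m)
  have "(\<Sum>k=0..n. (a k - b k) * falling_factorial (real m) k) = 0"
    using eq[of "real m"] by (simp add: left_diff_distrib sum_subtractf)
  also have "(\<Sum>k=0..n. (a k - b k) * falling_factorial (real m) k)
      = (\<Sum>k\<in>{m}. (a k - b k) * falling_factorial (real m) k)"
  proof (rule sum.mono_neutral_right)
    show "\<forall>k\<in>{0..n} - {m}. (a k - b k) * falling_factorial (real m) k = 0"
    proof
      fix k assume k: "k \<in> {0..n} - {m}"
      then consider "k < m" | "m < k"
        by fastforce
      then show "(a k - b k) * falling_factorial (real m) k = 0"
        using less.IH[of k] k by cases (auto simp: falling_factorial_of_nat_eq_0_iff)
    qed
  qed (use less.prems in auto)
  finally show ?case
    by (simp add: falling_factorial_of_nat_eq_0_iff)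
qed

(* Unshifted indices: stirling_array lam r n k is H_lam^(r)(n + r, k + r). *)
fun stirling_array :: "real \<Rightarrow> nat \<Rightarrow> nat \<Rightarrow> nat \<Rightarrow> real" where
  "stirling_array lam r 0 k = (if k = 0 then 1 else 0)"
| "stirling_array lam r (Suc n) 0 = (real r + real n * lam) * stirling_array lam r n 0"
| "stirling_array lam r (Suc n) (Suc k) = stirling_array lam r n k
     + (real (Suc k) + real r + real n * lam) * stirling_array lam r n (Suc k)"

lemma stirling_array_eq_0: "n < k \<Longrightarrow> stirling_array lam r n k = 0"
  by (induction lam r n k rule: stirling_array.induct) auto

lemma rising_factorial_eq_sum_stirling_array:
  "rising_factorial lam (x + real r) n
     = (\<Sum>k=0..n. stirling_array lam r n k * falling_factorial x k)"
proof (induction n)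
  case 0
  then show ?case
    by (simp add: rising_factorial_def falling_factorial_def)
next
  case (Suc n)
  let ?T = "stirling_array lam r n" and ?F = "falling_factorial x"
  let ?c = "\<lambda>k. real k + real r + real n * lam"
  have "rising_factorial lam (x + real r) (Suc n)
      = (\<Sum>k=0..n. ?T k * ?F k * (x + real r + real n * lam))"
    by (simp add: rising_factorial_Suc Suc.IH sum_distrib_right)
  \<comment> \<open>The part \<open>x - real k\<close> of the new factor raises \<open>?F k\<close>
    to \<open>?F (Suc k)\<close>; the rest, \<open>?c k\<close>, is free of
    \<open>x\<close>.\<close>
  also have "\<dots> = (\<Sum>k=0..n. ?T k * ?F (Suc k) + ?c k * ?T k * ?F k)"
    by (rule sum.cong) (simp_all add: falling_factorial_Suc algebra_simps)
  also have "\<dots> = (\<Sum>k=0..n. ?T k * ?F (Suc k)) + (\<Sum>k=0..n. ?c k * ?T k * ?F k)"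
    by (rule sum.distrib)
  \<comment> \<open>The added top term is zero because \<open>?T (Suc n) = 0\<close>. Splitting off
    \<open>k = 0\<close> then leaves a sum in \<open>?F (Suc k)\<close> over the same range as the
    first one.\<close>
  also have "(\<Sum>k=0..n. ?c k * ?T k * ?F k) = (\<Sum>k=0..Suc n. ?c k * ?T k * ?F k)"
    by (simp add: stirling_array_eq_0)
  also have "\<dots> = ?c 0 * ?T 0 * ?F 0 + (\<Sum>k=0..n. ?c (Suc k) * ?T (Suc k) * ?F (Suc k))"
    by (rule sum.atLeast0_atMost_Suc_shift[unfolded o_def])
  also have "(\<Sum>k=0..n. ?T k * ?F (Suc k)) + \<dots>
      = ?c 0 * ?T 0 * ?F 0 + (\<Sum>k=0..n. (?T k + ?c (Suc k) * ?T (Suc k)) * ?F (Suc k))"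
    by (simp add: algebra_simps sum.distrib)
  also have "\<dots> = (\<Sum>k=0..Suc n. stirling_array lam r (Suc n) k * ?F k)"
    unfolding sum.atLeast0_atMost_Suc_shift by simp
  finally show ?case .
qed

text \<open>This discharges the definite description: the explicit array is a witness, and comparing
  coefficients in each row makes it the only one.\<close>

lemma hstirling2_eq_stirling_array:
  "hstirling2 lam r (n + r) (k + r) = stirling_array lam r n k"
proof -
  \<comment> \<open>The guard \<open>K < r\<close> matters: truncated subtraction would otherwise
    read column 0 there instead of the prescribed zero.\<close>
  define H where
    "H N K = (if N < r \<or> K < r then 0 else stirling_array lam r (N - r) (K - r))" for N K
  have "hstirling2 lam r = H"
    unfolding hstirling2_def
  proof (rule the_equality, goal_cases)
    case 1
    show ?case
      by (auto simp: H_def rising_factorial_eq_sum_stirling_array intro!: stirling_array_eq_0)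
  next
    case (2 G)
    note G = this
    show ?case
    proof (intro ext)
      fix N K
      \<comment> \<open>One case for each clause of the description: missing rows, prescribed zeros,
        and the range governed by the polynomial identity.\<close>
      consider "N < r" | n where "N = n + r" "K < r \<or> K > n + r"
        | n k where "N = n + r" "K = k + r" "k \<le> n"
        by (metis add.commute add_le_cancel_right le_Suc_ex not_less)
      then show "G N K = H N K"
      proof cases
        case 1
        then show ?thesis using G by (simp add: H_def)
      next
        case (2 n)
        then show ?thesis
          using G by (auto simp: H_def stirling_array_eq_0)
      next
        case (3 n k)
        have "G (n + r) (k + r) = stirling_array lam r n k"
        proof (rule falling_factorial_coeffs_unique[OF _ \<open>k \<le> n\<close>])
          \<comment> \<open>Both sums equal
            \<open>rising_factorial lam (x + real r) n\<close>.\<close>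
          show "(\<Sum>k=0..n. G (n + r) (k + r) * falling_factorial x k)
              = (\<Sum>k=0..n. stirling_array lam r n k * falling_factorial x k)" for x
            using G by (simp flip: rising_factorial_eq_sum_stirling_array)
        qed
        with 3 show ?thesis by (simp add: H_def)
      qed
    qed
  qed
  then show ?thesis by (simp add: H_def)
qed

theorem mainTheorem13:
  fixes lam :: real and r n k :: nat
  assumes "lam \<noteq> 0" and "r > 0" and "n > 0" and "k > 0"
  shows "hstirling2 lam r (n + 1 + r) (k + r)
    = hstirling2 lam r (n + r) (k + r - 1)
      + (real k + real r + real n * lam) * hstirling2 lam r (n + r) (k + r)"
proof -
  \<comment> \<open>Writing \<open>k\<close> as a successor turns the truncated
    \<open>k + r - 1\<close> into the shifted index \<open>j + r\<close> and selects the third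
    equation of \<open>stirling_array\<close>.\<close>
  obtain j where k: "k = Suc j"
    using \<open>k > 0\<close> gr0_implies_Suc by blast
  then have "k + r - 1 = j + r"
    by simp
  then show ?thesis
    unfolding hstirling2_eq_stirling_array using k by (simp add: hstirling2_eq_stirling_array)
qed

end
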